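(* Let $g\ge 2$ be an integer, and let $S_{1,g,g+1}$ be the greedy 3-sumfree sequence starting with $1,g,g+1$. Then for every positive integer $z$, \[ z \text{ is a term of } S_{1,g,g+1} \iff z\in\{1,\,2g+1,\,6g+1\}\ \text{ or }\ z\bmod(10g+3)\in[g,2g]\cup[6g+2,7g+1]. \] In particular, after the first $g+4$ terms, the sequence modulo $10g+3$ is periodic with period length $2g+1$; that is, writing the terms in increasing order as $s_1<s_2<s_3<\cdots$, one has $s_{i+2g+1}\equiv s_i \pmod{10g+3}$ for all $i>g+4$.
   Context: For positive integers $x<y<z$, the greedy 3-sumfree sequence $S_{x,y,z}$ is the increasing sequence that begins with $x,y,z$ and then continues by the rule that each new term is the least positive integer exceeding the preceding term that is not a sum of three distinct earlier terms of the sequence. For integers $u,v$, $[u,v]=\{n\in\mathbb Z: u\le n\le v\}$ (empty if $u>v$). For a positive integer $z$, $z\bmod(10g+3)$ denotes the remainder in $\{0,1,\dots,10g+2\}$ of $z$ upon division by $10g+3$. *)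

theory Defs
  imports "HOL-Number_Theory.Cong"
begin

definition sum_of_three_distinct :: "nat set \<Rightarrow> nat \<Rightarrow> bool" where
  "sum_of_three_distinct A m \<longleftrightarrow>
     (\<exists>a\<in>A. \<exists>b\<in>A. \<exists>c\<in>A. a \<noteq> b \<and> a \<noteq> c \<and> b \<noteq> c \<and> m = a + b + c)"

text \<open>The terms are numbered from 1; index 0 carries a dummy value that the recursion never uses.
  The sequence is intended for \<open>0 < x < y < z\<close>.\<close>

function greedy_3sumfree :: "nat \<Rightarrow> nat \<Rightarrow> nat \<Rightarrow> nat \<Rightarrow> nat" where
  "greedy_3sumfree x y z n =
     (if n = 0 then 0
      else if n = 1 then x
      else if n = 2 then y
      else if n = 3 then z
      else (LEAST m. greedy_3sumfree x y z (n - 1) < m \<and>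
              \<not> sum_of_three_distinct (greedy_3sumfree x y z ` {1..<n}) m))"
  by pat_completeness auto
termination
  by (relation "measure (\<lambda>(x, y, z, n). n)") auto

declare greedy_3sumfree.simps [simp del]

definition greedy_3sumfree_terms :: "nat \<Rightarrow> nat \<Rightarrow> nat \<Rightarrow> nat set" where
  "greedy_3sumfree_terms x y z = greedy_3sumfree x y z ` {1..}"

lemma finite_sums_of_three_distinct:
  assumes "finite A"
  shows "finite {m. sum_of_three_distinct A m}"
proof (rule finite_subset)
  show "{m. sum_of_three_distinct A m} \<subseteq> (\<lambda>(a, b, c). a + b + c) ` (A \<times> A \<times> A)"
    by (force simp: sum_of_three_distinct_def)
  show "finite ((\<lambda>(a, b, c). a + b + c) ` (A \<times> A \<times> A))"
    using assms by simp
qed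

text \<open>The minimum in the recursion is always attained, so \<open>LEAST\<close> is used properly.\<close>

lemma greedy_3sumfree_step:
  assumes "3 < n"
  shows "greedy_3sumfree x y z (n - 1) < greedy_3sumfree x y z n"
    and "\<not> sum_of_three_distinct (greedy_3sumfree x y z ` {1..<n}) (greedy_3sumfree x y z n)"
proof -
  let ?s = "greedy_3sumfree x y z"
  let ?P = "\<lambda>m. ?s (n - 1) < m \<and> \<not> sum_of_three_distinct (?s ` {1..<n}) m"
  have "finite ({..?s (n - 1)} \<union> {m. sum_of_three_distinct (?s ` {1..<n}) m})"
    by (simp add: finite_sums_of_three_distinct)
  then obtain m where "m \<notin> {..?s (n - 1)} \<union> {m. sum_of_three_distinct (?s ` {1..<n}) m}"
    using ex_new_if_finite infinite_UNIV_nat by blast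
  then have "?P m" by simp
  then have "?P (LEAST m. ?P m)" by (rule LeastI)
  moreover have "?s n = (LEAST m. ?P m)"
    using assms by (subst greedy_3sumfree.simps) simp
  ultimately show "?s (n - 1) < ?s n" "\<not> sum_of_three_distinct (?s ` {1..<n}) (?s n)"
    by simp_all
qed

lemma greedy_3sumfree_initial:
  "greedy_3sumfree x y z 0 = 0"
  "greedy_3sumfree x y z 1 = x"
  "greedy_3sumfree x y z 2 = y"
  "greedy_3sumfree x y z 3 = z"
  by (subst greedy_3sumfree.simps; simp)+

lemma strict_mono_greedy_3sumfree:
  assumes "0 < x" "x < y" "y < z"
  shows "strict_mono (greedy_3sumfree x y z)"
proof (rule strict_mono_Suc_iff[THEN iffD2], rule allI)
  fix n
  consider "n = 0" | "n = 1" | "n = 2" | "3 < Suc n" by linarith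
  then show "greedy_3sumfree x y z n < greedy_3sumfree x y z (Suc n)"
  proof cases
    case 4
    then show ?thesis using greedy_3sumfree_step(1)[of "Suc n" x y z] by simp
  qed (use assms greedy_3sumfree_initial[of x y z] in \<open>simp_all add: eval_nat_numeral\<close>)
qed

end

(* The explicit set T is characterised by the greedy recursion: above g + 1, a number lies in T iff it
   is not a sum of three distinct elements of T. Modulo N = 10g + 3, sums of three elements of T
   avoid the two residue blocks of T up to boundary cases that distinctness excludes. Conversely, let
   L = [g, 2g]. The sums of two distinct elements of {1}, [g, 2g+1], [6g+1, 7g+1] fill
   [g+1, 4g+1] and [6g+2, 9g+2]; adding an element of qN + L with q >= 1 fills exactly the gaps of T
   in the q-th period. Periodicity of the sequence then follows by counting: each window of N
   consecutive integers beyond 6g + 1 contains 2g + 1 elements of T. *)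

theory Submission imports Defs begin

section \<open>Sums of three distinct elements of a set\<close>

lemma sum_of_three_distinctI:
  "\<lbrakk>a \<in> A; b \<in> A; c \<in> A; a \<noteq> b; a \<noteq> c; b \<noteq> c; m = a + b + c\<rbrakk> \<Longrightarrow> sum_of_three_distinct A m"
  unfolding sum_of_three_distinct_def by blast

text \<open>Positive summands of \<open>n\<close> are smaller than \<open>n\<close>. This lets a
  finite prefix of the sequence replace its whole range, and lets strong induction compare two
  sets.\<close>

lemma sum_of_three_distinct_cong_below:
  assumes "0 \<notin> A" "0 \<notin> B" "\<And>k. k < n \<Longrightarrow> k \<in> A \<longleftrightarrow> k \<in> B"
  shows "sum_of_three_distinct A n \<longleftrightarrow> sum_of_three_distinct B n"
proof -
  have "sum_of_three_distinct D n"
    if "0 \<notin> C" "\<And>k. k < n \<Longrightarrow> k \<in> C \<longleftrightarrow> k \<in> D" and sum: "sum_of_three_distinct C n" for C D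
  proof -
    obtain a b c where abc: "a \<in> C" "b \<in> C" "c \<in> C" "a \<noteq> b" "a \<noteq> c" "b \<noteq> c" "n = a + b + c"
      using sum unfolding sum_of_three_distinct_def by blast
    then have "a > 0" "b > 0" "c > 0" using that(1) by (auto intro: gr0I)
    then have "a < n" "b < n" "c < n" using abc by auto
    then show ?thesis using that(2) abc by (intro sum_of_three_distinctI[of a D b c]) auto
  qed
  from this[of A B] this[of B A] show ?thesis using assms by blast
qed

section \<open>The terms of a greedy sequence\<close>

context
  fixes x y z :: nat
  assumes xyz: "0 < x" "x < y" "y < z"
begin

lemma greedy_terms_pos: "0 \<notin> greedy_3sumfree_terms x y z"
proof
  assume "0 \<in> greedy_3sumfree_terms x y z"
  then obtain k where "k \<ge> 1" "greedy_3sumfree x y z k = 0"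
    unfolding greedy_3sumfree_terms_def by force
  then show False
    using strict_monoD[OF strict_mono_greedy_3sumfree[OF xyz], of 0 k] by simp
qed

lemma greedy_terms_atMost:
  assumes "k \<ge> 1"
  shows "greedy_3sumfree_terms x y z \<inter> {..greedy_3sumfree x y z k} = greedy_3sumfree x y z ` {1..k}"
  using strict_mono_less_eq[OF strict_mono_greedy_3sumfree[OF xyz]] assms
  unfolding greedy_3sumfree_terms_def by auto

lemma greedy_terms_initial:
  assumes "n \<le> z"
  shows "n \<in> greedy_3sumfree_terms x y z \<longleftrightarrow> n \<in> {x, y, z}"
proof -
  have "{1..3} = {1, 2, 3::nat}" by auto
  then have "greedy_3sumfree_terms x y z \<inter> {..z} = {x, y, z}"
    using greedy_terms_atMost[of 3] by (simp add: greedy_3sumfree_initial greedy_3sumfree_initial(2)[simplified])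
  then show ?thesis using assms by blast
qed

text \<open>Removes indices and \<open>LEAST\<close> from the recursion: terms added later exceed
  \<open>n\<close>, so they cannot change whether \<open>n\<close> is a sum of three terms.\<close>

lemma greedy_terms_iff:
  assumes "n > z"
  shows "n \<in> greedy_3sumfree_terms x y z \<longleftrightarrow> \<not> sum_of_three_distinct (greedy_3sumfree_terms x y z) n"
proof -
  let ?s = "greedy_3sumfree x y z"
  let ?A = "greedy_3sumfree_terms x y z"
  have mono: "strict_mono ?s" by (rule strict_mono_greedy_3sumfree[OF xyz])
  \<comment> \<open>The first index whose term reaches \<open>n\<close>; it exists because strict
    monotonicity gives \<open>n \<le> ?s n\<close>. Both sides of the equivalence amount to
    \<open>n = ?s k\<close>.\<close>
  define k where "k = (LEAST k. n \<le> ?s k)"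
  have nk: "n \<le> ?s k"
    unfolding k_def by (rule LeastI[of _ n]) (rule strict_mono_imp_increasing[OF mono])
  have below: "?s j < n" if "j < k" for j
    using not_less_Least[of j "\<lambda>k. n \<le> ?s k"] that unfolding k_def by simp
  \<comment> \<open>The first three terms are prescribed; the \<open>LEAST\<close> clause applies
    only from index 4 on.\<close>
  have k3: "k > 3"
  proof (rule ccontr)
    assume "\<not> k > 3"
    then have "?s k \<le> ?s 3" using strict_mono_less_eq[OF mono] by simp
    then show False using nk assms by (simp add: greedy_3sumfree_initial)
  qed
  have prefix: "sum_of_three_distinct ?A n \<longleftrightarrow> sum_of_three_distinct (?s ` {1..<k}) n"
  proof (rule sum_of_three_distinct_cong_below)
    show "0 \<notin> ?A" by (rule greedy_terms_pos)
    then show "0 \<notin> ?s ` {1..<k}" unfolding greedy_3sumfree_terms_def by force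
    fix j assume "j < n"
    then have "j < ?s k" using nk by simp
    then show "j \<in> ?A \<longleftrightarrow> j \<in> ?s ` {1..<k}"
      using strict_mono_less[OF mono] unfolding greedy_3sumfree_terms_def by auto
  qed
  have "n = ?s k" if "n \<in> ?A"
  proof -
    obtain j where "n = ?s j" using \<open>n \<in> ?A\<close> unfolding greedy_3sumfree_terms_def by blast
    moreover from this have "j \<ge> k" using below[of j] by fastforce
    ultimately show ?thesis using nk strict_mono_less_eq[OF mono, of k j] by simp
  qed
  moreover have "?s k \<in> ?A" using k3 unfolding greedy_3sumfree_terms_def by simp
  \<comment> \<open>Here \<open>n\<close> competes in the minimum defining \<open>?s k\<close>,
    since \<open>?s (k - 1) < n\<close>.\<close>
  moreover have "n = ?s k" if "\<not> sum_of_three_distinct (?s ` {1..<k}) n"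
  proof -
    have "?s k = (LEAST m. ?s (k - 1) < m \<and> \<not> sum_of_three_distinct (?s ` {1..<k}) m)"
      using k3 by (subst greedy_3sumfree.simps) simp
    also have "\<dots> \<le> n" using below[of "k - 1"] k3 that by (intro Least_le) simp
    finally show ?thesis using nk by simp
  qed
  ultimately show ?thesis
    using prefix greedy_3sumfree_step(2)[OF k3, of x y z] by metis
qed

text \<open>The criterion for \<open>n\<close> depends only on elements below \<open>n\<close>, so
  strong induction determines the set.\<close>

lemma greedy_terms_eqI:
  assumes "0 \<notin> T"
    and initial: "\<And>n. n \<le> z \<Longrightarrow> n \<in> T \<longleftrightarrow> n \<in> {x, y, z}"
    and later: "\<And>n. n > z \<Longrightarrow> n \<in> T \<longleftrightarrow> \<not> sum_of_three_distinct T n"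
  shows "greedy_3sumfree_terms x y z = T"
proof -
  have "n \<in> greedy_3sumfree_terms x y z \<longleftrightarrow> n \<in> T" for n
  proof (induction n rule: less_induct)
    case (less n)
    show ?case
    proof (cases "n \<le> z")
      case True
      then show ?thesis using initial greedy_terms_initial by blast
    next
      case False
      then show ?thesis
        using later[of n] greedy_terms_iff[of n]
          sum_of_three_distinct_cong_below[OF greedy_terms_pos \<open>0 \<notin> T\<close> less.IH] by simp
    qed
  qed
  then show ?thesis by blast
qed

text \<open>Recovers the index of a term from a count, which turns periodicity of the set into
  periodicity of the sequence.\<close>

lemma greedy_rank:
  assumes "k \<ge> 1"
  shows "card (greedy_3sumfree_terms x y z \<inter> {..greedy_3sumfree x y z k}) = k"
  using greedy_terms_atMost[OF assms]
    card_image[OF strict_mono_imp_inj_on[OF strict_mono_greedy_3sumfree[OF xyz]], of "{1..k}"]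
  by (simp add: inj_on_subset)

end

section \<open>The explicit set\<close>

definition explicit_terms :: "nat \<Rightarrow> nat set" where
  "explicit_terms g = {n. n \<in> {1, 2 * g + 1, 6 * g + 1} \<or>
     n mod (10 * g + 3) \<in> {g..2 * g} \<union> {6 * g + 2..7 * g + 1}}"

lemma explicit_terms_first_period:
  assumes "n < 10 * g + 3"
  shows "n \<in> explicit_terms g \<longleftrightarrow>
    n = 1 \<or> n \<in> {g..2 * g + 1} \<or> n \<in> {6 * g + 1..7 * g + 1}"
  using assms unfolding explicit_terms_def by auto

lemma explicit_terms_later_period:
  assumes "q \<ge> 1" "r < 10 * g + 3"
  shows "q * (10 * g + 3) + r \<in> explicit_terms g \<longleftrightarrow> r \<in> {g..2 * g} \<union> {6 * g + 2..7 * g + 1}"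
proof -
  define M where "M = q * (10 * g + 3)"
  have "1 * (10 * g + 3) \<le> M" unfolding M_def using assms(1) by (rule mult_le_mono1)
  moreover have "(M + r) mod (10 * g + 3) = r" using assms(2) unfolding M_def by simp
  ultimately show ?thesis using assms(2) unfolding explicit_terms_def M_def[symmetric] by auto
qed

section \<open>Sums that fill the gaps between the blocks\<close>

lemma two_sums_first_period:
  assumes "t \<in> {g + 1..4 * g + 1} \<or> t \<in> {6 * g + 2..9 * g + 2}" "g \<ge> 2"
  shows "\<exists>a b. a \<in> explicit_terms g \<and> b \<in> explicit_terms g \<and> a < b \<and> b < 10 * g + 3 \<and> t = a + b"
proof -
  consider "t \<in> {g + 1..2 * g + 2}" | "t \<in> {2 * g + 3..3 * g}" | "t \<in> {3 * g + 1..4 * g + 1}" "t > 2 * g + 2"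
    | "t \<in> {6 * g + 2..7 * g + 2}" | "t \<in> {7 * g + 3..8 * g + 1}" | "t \<in> {8 * g + 2..9 * g + 2}"
    using assms by fastforce
  then have "\<exists>a b. (a = 1 \<or> a \<in> {g..2 * g + 1}) \<and> (b \<in> {g..2 * g + 1} \<or> b \<in> {6 * g + 1..7 * g + 1})
      \<and> a < b \<and> t = a + b"
  proof cases
    case 1 then show ?thesis using assms(2) by (intro exI[of _ 1] exI[of _ "t - 1"]) auto
  next
    case 2 then show ?thesis by (intro exI[of _ g] exI[of _ "t - g"]) auto
  next
    case 3 then show ?thesis by (intro exI[of _ "t - (2 * g + 1)"] exI[of _ "2 * g + 1"]) auto
  next
    case 4 then show ?thesis using assms(2) by (intro exI[of _ 1] exI[of _ "t - 1"]) auto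
  next
    case 5 then show ?thesis by (intro exI[of _ g] exI[of _ "t - g"]) auto
  next
    case 6 then show ?thesis using assms(2) by (intro exI[of _ "t - (7 * g + 1)"] exI[of _ "7 * g + 1"]) auto
  qed
  then obtain a b where "a = 1 \<or> a \<in> {g..2 * g + 1}"
      "b \<in> {g..2 * g + 1} \<or> b \<in> {6 * g + 1..7 * g + 1}" "a < b" "t = a + b"
    by blast
  then show ?thesis
    by (intro exI[of _ a] exI[of _ b]) (auto simp: explicit_terms_first_period)
qed

lemma sum_of_three_later_period:
  assumes "q \<ge> 1" "r \<in> {2 * g + 1..6 * g + 1} \<or> r \<in> {7 * g + 2..11 * g + 2}" "g \<ge> 2"
  shows "sum_of_three_distinct (explicit_terms g) (q * (10 * g + 3) + r)"
proof -
  \<comment> \<open>Choose \<open>l\<close> as large as possible in its block while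
    \<open>r - l\<close> does not drop below the left end of a range of two-element sums,
    \<open>g + 1\<close> or \<open>6 * g + 2\<close>.\<close>
  have "\<exists>l. l \<in> {g..2 * g} \<and> l \<le> r \<and>
      (r - l \<in> {g + 1..4 * g + 1} \<or> r - l \<in> {6 * g + 2..9 * g + 2})"
    using assms(2)
  proof
    assume "r \<in> {2 * g + 1..6 * g + 1}"
    then show ?thesis by (intro exI[of _ "min (2 * g) (r - (g + 1))"]) auto
  next
    assume "r \<in> {7 * g + 2..11 * g + 2}"
    then show ?thesis by (intro exI[of _ "min (2 * g) (r - (6 * g + 2))"]) auto
  qed
  then obtain l where l: "l \<in> {g..2 * g}" "l \<le> r"
    "r - l \<in> {g + 1..4 * g + 1} \<or> r - l \<in> {6 * g + 2..9 * g + 2}" by blast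
  obtain a b where ab: "a \<in> explicit_terms g" "b \<in> explicit_terms g" "a < b" "b < 10 * g + 3" "r - l = a + b"
    using two_sums_first_period[OF l(3) assms(3)] by blast
  define M where "M = q * (10 * g + 3)"
  have "M + l \<in> explicit_terms g"
    using l(1) unfolding M_def by (subst explicit_terms_later_period[OF assms(1)]) auto
  \<comment> \<open>Hence \<open>M + l\<close> is at least the modulus and differs from
    \<open>a\<close> and \<open>b\<close>, which lie below it.\<close>
  moreover have "1 * (10 * g + 3) \<le> M" unfolding M_def using assms(1) by (rule mult_le_mono1)
  ultimately show ?thesis
    using ab l(2) unfolding M_def[symmetric]
    by (intro sum_of_three_distinctI[of "M + l" _ a b]) auto
qed

text \<open>All three summands come from the first period. The second range runs past the modulus to
  \<open>11 * g + 2\<close> so as to include the residues below \<open>g\<close> of the next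
  period.\<close>

lemma sum_of_three_initial:
  assumes "n \<in> {2 * g + 2..6 * g} \<or> n \<in> {7 * g + 2..11 * g + 2}" "g \<ge> 2"
  shows "sum_of_three_distinct (explicit_terms g) n"
proof -
  consider "n \<in> {2 * g + 2..3 * g + 1}" | "n \<in> {3 * g + 2..4 * g}" | "n \<in> {4 * g + 1..5 * g + 1}" "n \<ge> 3 * g + 3"
    | "n \<in> {5 * g + 2..6 * g}"
    | "n \<in> {7 * g + 2..8 * g + 2}" | "n \<in> {8 * g + 3..9 * g + 3}" | "n \<in> {9 * g + 4..10 * g + 2}"
    | "n \<in> {10 * g + 3..11 * g + 2}"
    using assms by fastforce
  then have "\<exists>a b c. (a = 1 \<or> a \<in> {g..2 * g + 1}) \<and> b \<in> {g..2 * g + 1} \<and>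
      (c \<in> {g..2 * g + 1} \<or> c \<in> {6 * g + 1..7 * g + 1}) \<and> a < b \<and> b < c \<and> n = a + b + c"
  proof cases
    case 1 then show ?thesis using assms(2) by (intro exI[of _ 1] exI[of _ g] exI[of _ "n - (g + 1)"]) auto
  next
    case 2 then show ?thesis
      using assms(2) by (intro exI[of _ 1] exI[of _ "n - (2 * g + 1)"] exI[of _ "2 * g"]) auto
  next
    case 3
    show ?thesis
    \<comment> \<open>At this value the general middle summand \<open>n - (3 * g + 1)\<close> would
      be \<open>g\<close> and repeat the first one.\<close>
    proof (cases "n = 4 * g + 1")
      case True
      then show ?thesis using assms(2) 3 by (intro exI[of _ g] exI[of _ "g + 1"] exI[of _ "2 * g"]) auto
    next
      case False
      then show ?thesis
        using assms(2) 3 by (intro exI[of _ g] exI[of _ "n - (3 * g + 1)"] exI[of _ "2 * g + 1"]) auto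
    qed
  next
    case 4 then show ?thesis
      by (intro exI[of _ "n - (4 * g + 1)"] exI[of _ "2 * g"] exI[of _ "2 * g + 1"]) auto
  next
    case 5 then show ?thesis using assms(2) by (intro exI[of _ 1] exI[of _ g] exI[of _ "n - (g + 1)"]) auto
  next
    case 6 then show ?thesis
      using assms(2) by (intro exI[of _ 1] exI[of _ "n - (7 * g + 2)"] exI[of _ "7 * g + 1"]) auto
  next
    case 7 then show ?thesis
      using assms(2) by (intro exI[of _ g] exI[of _ "n - (8 * g + 1)"] exI[of _ "7 * g + 1"]) auto
  next
    case 8 then show ?thesis
      using assms(2) by (intro exI[of _ "2 * g"] exI[of _ "2 * g + 1"] exI[of _ "n - (4 * g + 1)"]) auto
  qed
  then obtain a b c where abc: "a = 1 \<or> a \<in> {g..2 * g + 1}" "b \<in> {g..2 * g + 1}"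
      "c \<in> {g..2 * g + 1} \<or> c \<in> {6 * g + 1..7 * g + 1}" "a < b" "b < c" "n = a + b + c"
    by blast
  then show ?thesis
    by (intro sum_of_three_distinctI[of a _ b c]) (auto simp: explicit_terms_first_period)
qed

section \<open>Residues of sums of three elements\<close>

lemma explicit_terms_sumfree:
  assumes "g \<ge> 2" "n > g + 1" "n \<in> explicit_terms g"
  shows "\<not> sum_of_three_distinct (explicit_terms g) n"
proof
  assume "sum_of_three_distinct (explicit_terms g) n"
  then obtain a b c where mem: "a \<in> explicit_terms g" "b \<in> explicit_terms g" "c \<in> explicit_terms g"
    and dist: "a \<noteq> b" "a \<noteq> c" "b \<noteq> c" and n: "n = a + b + c"
    unfolding sum_of_three_distinct_def by blast
  define N where "N = 10 * g + 3"
  \<comment> \<open>Exceptional elements keep their actual value beside the residue: each of the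
    residues 1, \<open>2 * g + 1\<close> and \<open>6 * g + 1\<close> then belongs to a single
    element, so distinct summands cannot share it.\<close>
  define P where "P = (\<lambda>k r. k = 1 \<and> r = 1
      \<or> g \<le> r \<and> r \<le> 2 * g \<or> k = 2 * g + 1 \<and> r = 2 * g + 1
      \<or> k = 6 * g + 1 \<and> r = 6 * g + 1 \<or> 6 * g + 2 \<le> r \<and> r \<le> 7 * g + 1)"
  have P: "P k (k mod N)" if "k \<in> explicit_terms g" for k
    using that unfolding explicit_terms_def P_def N_def by auto
  define ra rb rc where r: "ra = a mod N" "rb = b mod N" "rc = c mod N"
  have Pabc: "P a ra" "P b rb" "P c rc" using P mem unfolding r by auto
  define s where "s = ra + rb + rc"
  \<comment> \<open>The bands arise from 0, 1, 2 or 3 summands with residue at least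
    \<open>6 * g + 1\<close>. Their ends are chosen as the gaps between consecutive translates, by
    multiples of \<open>N\<close>, of the two residue blocks.\<close>
  have s: "2 * g + 1 \<le> s \<and> s \<le> 6 * g + 1 \<or> 7 * g + 2 \<le> s \<and> s \<le> 11 * g + 2
      \<or> 12 * g + 4 \<le> s \<and> s \<le> 16 * g + 4 \<or> 17 * g + 5 \<le> s \<and> s \<le> 21 * g + 5"
    using Pabc dist assms(1) unfolding P_def s_def by (elim disjE conjE) simp_all
  have mod_eq: "n mod N = s mod N" unfolding n r s_def by (metis mod_add_eq mod_mod_trivial)
  define d where "d = s div N"
  have "s = N * d + n mod N" unfolding d_def mod_eq by simp
  moreover have "d < 3" using s unfolding d_def N_def by (intro less_mult_imp_div_less) auto
  then have "d = 0 \<or> d = 1 \<or> d = 2" by auto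
  ultimately have "s = n mod N \<or> s = N + n mod N \<or> s = 2 * N + n mod N" by auto
  moreover have "n mod N < N" unfolding N_def by simp
  ultimately have "n mod N \<notin> {g..2 * g} \<union> {6 * g + 2..7 * g + 1}"
    using s assms(1) unfolding N_def by auto
  \<comment> \<open>Only exceptional values remain. The least possible sum
    \<open>1 + g + (g + 1)\<close> exceeds \<open>2 * g + 1\<close> by one. Without a summand of at
    least \<open>6 * g + 1\<close>, the greatest sum
    \<open>(2 * g - 1) + 2 * g + (2 * g + 1)\<close> misses \<open>6 * g + 1\<close> by one; with
    such a summand the sum exceeds it.\<close>
  then have small: "n = 2 * g + 1 \<or> n = 6 * g + 1"
    using assms unfolding explicit_terms_def N_def by auto
  then have "a < N" "b < N" "c < N" using n unfolding N_def by auto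
  then have "k = 1 \<or> g \<le> k \<and> k \<le> 2 * g + 1 \<or> 6 * g + 1 \<le> k" if "k \<in> {a, b, c}" for k
    using that mem unfolding N_def by (auto simp: explicit_terms_first_period)
  from this[of a] this[of b] this[of c] show False
    using small n dist assms(1) by auto
qed

section \<open>The greedy rule for the explicit set\<close>

lemma explicit_terms_iff:
  assumes "g \<ge> 2" "n > g + 1"
  shows "n \<in> explicit_terms g \<longleftrightarrow> \<not> sum_of_three_distinct (explicit_terms g) n"
proof
  show "\<not> sum_of_three_distinct (explicit_terms g) n" if "n \<in> explicit_terms g"
    using explicit_terms_sumfree[OF assms that] .
  have "sum_of_three_distinct (explicit_terms g) n" if notin: "n \<notin> explicit_terms g"
  proof (cases "n < 10 * g + 3")
    case True
    then show ?thesis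
      using notin assms by (intro sum_of_three_initial) (auto simp: explicit_terms_first_period)
  next
    case False
    define N where "N = 10 * g + 3"
    define q r where "q = n div N" and "r = n mod N"
    have n: "n = q * N + r" unfolding q_def r_def by simp
    have q: "q \<ge> 1" using False unfolding q_def N_def by (simp add: div_greater_zero_iff Suc_le_eq)
    have r: "r < N" unfolding r_def N_def by simp
    have R: "r \<notin> {g..2 * g} \<union> {6 * g + 2..7 * g + 1}"
      using notin explicit_terms_later_period[OF q r[unfolded N_def]] unfolding n N_def by simp
    show ?thesis
    proof (cases "r < g")
      case False
      then show ?thesis
        using R r assms(1) unfolding n N_def by (intro sum_of_three_later_period[OF q]) auto
    next
      \<comment> \<open>Residues below \<open>g\<close> precede the ranges of
        \<open>sum_of_three_later_period\<close>, so they are read as \<open>N + r\<close> over the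
        preceding period; for \<open>q = 1\<close> that is the first period, and the initial ranges
        apply.\<close>
      case r_small: True
      show ?thesis
      proof (cases "q = 1")
        case True
        then show ?thesis
          using n r_small assms(1) unfolding N_def by (intro sum_of_three_initial) auto
      next
        case False
        then obtain p where p: "q = Suc p" "p \<ge> 1" using q by (cases q) auto
        then have "n = p * N + (N + r)" using n by simp
        then show ?thesis
          using p(2) r_small assms(1) unfolding N_def by (auto intro: sum_of_three_later_period)
      qed
    qed
  qed
  then show "n \<in> explicit_terms g" if "\<not> sum_of_three_distinct (explicit_terms g) n"
    using that by blast
qed

lemma greedy_terms_explicit:
  assumes "g \<ge> 2"
  shows "greedy_3sumfree_terms 1 g (g + 1) = explicit_terms g"
proof (rule greedy_terms_eqI)
  show "0 \<notin> explicit_terms g" using assms by (simp add: explicit_terms_first_period)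
  show "n \<in> explicit_terms g \<longleftrightarrow> n \<in> {1, g, g + 1}" if "n \<le> g + 1" for n
    using that assms by (auto simp: explicit_terms_first_period)
  show "n \<in> explicit_terms g \<longleftrightarrow> \<not> sum_of_three_distinct (explicit_terms g) n" if "n > g + 1" for n
    using explicit_terms_iff[OF assms that] .
qed (use assms in auto)

section \<open>Periodicity\<close>

text \<open>Past the exceptional elements, membership depends on the residue alone.\<close>

lemma explicit_terms_shift:
  assumes "n > 6 * g + 1"
  shows "n + (10 * g + 3) \<in> explicit_terms g \<longleftrightarrow> n \<in> explicit_terms g"
  using assms unfolding explicit_terms_def by auto

text \<open>Sliding the window by one trades \<open>Suc n\<close> for its translate by
  \<open>10 * g + 3\<close>, which has the same membership status. So one count suffices: from
  \<open>6 * g + 1\<close>, an upper block of \<open>g\<close> elements and the next lower block of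
  \<open>g + 1\<close>.\<close>

lemma card_explicit_terms_window:
  assumes "n \<ge> 6 * g + 1"
  shows "card (explicit_terms g \<inter> {n<..n + (10 * g + 3)}) = 2 * g + 1"
  using assms
proof (induction n rule: nat_induct_at_least)
  case base
  let ?N = "10 * g + 3"
  have "k \<in> explicit_terms g \<inter> {6 * g + 1<..6 * g + 1 + ?N} \<longleftrightarrow>
      k \<in> {6 * g + 2..7 * g + 1} \<union> {?N + g..?N + 2 * g}" for k
  proof (cases "k < ?N")
    case True
    then show ?thesis by (auto simp: explicit_terms_first_period)
  next
    case False
    define r where "r = k - ?N"
    have "k = ?N + r" using False unfolding r_def by simp
    then show ?thesis
      using explicit_terms_later_period[of 1 r g] by (cases "r < ?N") auto
  qed
  then have "explicit_terms g \<inter> {6 * g + 1<..6 * g + 1 + ?N} =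
      {6 * g + 2..7 * g + 1} \<union> {?N + g..?N + 2 * g}" by blast
  also have "card \<dots> = 2 * g + 1" by (subst card_Un_disjoint) auto
  finally show ?case .
next
  case (Suc n)
  let ?N = "10 * g + 3"
  let ?W = "explicit_terms g \<inter> {Suc n<..n + ?N}"
  have "{n<..n + ?N} = insert (Suc n) {Suc n<..n + ?N}"
    "{Suc n<..Suc n + ?N} = insert (Suc n + ?N) {Suc n<..n + ?N}" by auto
  then have "explicit_terms g \<inter> {n<..n + ?N} = (if Suc n \<in> explicit_terms g then insert (Suc n) ?W else ?W)"
    "explicit_terms g \<inter> {Suc n<..Suc n + ?N} =
      (if Suc n \<in> explicit_terms g then insert (Suc n + ?N) ?W else ?W)"
    using explicit_terms_shift[of g "Suc n"] Suc.hyps by auto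
  then show ?case using Suc.IH by (simp split: if_splits)
qed

text \<open>The translate of a term is again a term, and counting the terms in between gives its
  index. This yields an exact translation, stronger than a congruence.\<close>

lemma greedy_shift:
  assumes "g \<ge> 2" "i > g + 4"
  shows "greedy_3sumfree 1 g (g + 1) (i + 2 * g + 1) = greedy_3sumfree 1 g (g + 1) i + (10 * g + 3)"
proof -
  let ?s = "greedy_3sumfree 1 g (g + 1)"
  let ?T = "explicit_terms g"
  let ?N = "10 * g + 3"
  note T = greedy_terms_explicit[OF assms(1)]
  have rank: "card (?T \<inter> {..?s k}) = k" if "k \<ge> 1" for k
    using greedy_rank[of 1 g "g + 1" k] that assms(1) T by simp
  have "?s i \<in> ?T" using T assms(2) unfolding greedy_3sumfree_terms_def by force
  \<comment> \<open>Source of the threshold on \<open>i\<close>: at most \<open>g + 4\<close> terms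
    are at most \<open>6 * g + 1\<close>, namely 1, \<open>6 * g + 1\<close> and the
    \<open>g + 2\<close> members of \<open>{g..2 * g + 1}\<close>.\<close>
  have large: "?s i > 6 * g + 1"
  proof (rule ccontr)
    assume "\<not> ?s i > 6 * g + 1"
    then have "?T \<inter> {..?s i} \<subseteq> {1, 6 * g + 1} \<union> {g..2 * g + 1}"
      by (auto simp: explicit_terms_first_period)
    then have "i \<le> card ({1, 6 * g + 1} \<union> {g..2 * g + 1})"
      using rank[of i] assms(2) card_mono[of "{1, 6 * g + 1} \<union> {g..2 * g + 1}" "?T \<inter> {..?s i}"] by simp
    also have "\<dots> \<le> card {1, 6 * g + 1} + card {g..2 * g + 1}" by (rule card_Un_le)
    finally show False using assms by simp
  qed
  then have "?s i + ?N \<in> ?T" using explicit_terms_shift \<open>?s i \<in> ?T\<close> by blast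
  then obtain j where j: "j \<ge> 1" "?s j = ?s i + ?N"
    using T unfolding greedy_3sumfree_terms_def by force
  have "?T \<inter> {..?s j} = (?T \<inter> {..?s i}) \<union> (?T \<inter> {?s i<..?s i + ?N})" unfolding j(2) by auto
  then have "card (?T \<inter> {..?s j}) = card (?T \<inter> {..?s i}) + card (?T \<inter> {?s i<..?s i + ?N})"
    by (simp, subst card_Un_disjoint) auto
  then have "j = i + (2 * g + 1)"
    using rank[OF j(1)] rank[of i] assms(2) card_explicit_terms_window[of g "?s i"] large by simp
  then show ?thesis using j(2) by (simp add: add.assoc)
qed

theorem theorem1:
  fixes g :: nat
  assumes "g \<ge> 2"
  shows "(\<forall>z::nat. z > 0 \<longrightarrow>
            (z \<in> greedy_3sumfree_terms 1 g (g + 1) \<longleftrightarrow>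
               z \<in> {1, 2 * g + 1, 6 * g + 1} \<or>
               z mod (10 * g + 3) \<in> {g..2 * g} \<union> {6 * g + 2..7 * g + 1})) \<and>
         (\<forall>i::nat. i > g + 4 \<longrightarrow>
            [greedy_3sumfree 1 g (g + 1) (i + 2 * g + 1) = greedy_3sumfree 1 g (g + 1) i]
              (mod (10 * g + 3)))"
  using greedy_terms_explicit[OF assms] greedy_shift[OF assms]
  unfolding explicit_terms_def by (simp add: cong_def)

end
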